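(* The constructs (concrete categories over sets) $\mathbf{LSS}_{pt}$ (partially topological locally small spaces with bounded continuous mappings) and $\mathbf{OpenBorUniv}$ (bornological universes having open bases of the bornology, with bounded continuous mappings) are concretely isomorphic.
   Context: A locally small space is a pair $(X,\mathcal{L}_X)$ with $X$ any set and $\mathcal{L}_X\subseteq\mathcal{P}(X)$ such that $\emptyset\in\mathcal{L}_X$, $L\cap M,L\cup M\in\mathcal{L}_X$ for all $L,M\in\mathcal{L}_X$, and $\bigcup\mathcal{L}_X=X$. Put $\mathcal{L}_X^o=\{V\subseteq X:V\cap L\in\mathcal{L}_X\text{ for all }L\in\mathcal{L}_X\}$ (open sets), $\mathcal{L}_X^s=\{B\subseteq X:B\subseteq L\text{ for some }L\in\mathcal{L}_X\}$ (small sets), $\mathcal{L}_X^{wo}=\{\bigcup\mathcal{U}:\mathcal{U}\subseteq\mathcal{L}_X\}$ (weakly open sets; this is the smallest topology on $X$ containing $\mathcal{L}_X$), and $\mathcal{L}_X^{swo}=\mathcal{L}_X^{wo}\cap\mathcal{L}_X^s$ (small weakly open sets). A mapping $f:X\to Y$ between locally small spaces $(X,\mathcal{L}_X)$ and $(Y,\mathcal{L}_Y)$ is bounded if each $L\in\mathcal{L}_X$ is contained in $f^{-1}(M)$ for some $M\in\mathcal{L}_Y$, and continuous if $f^{-1}(M)\in\mathcal{L}_X^o$ for all $M\in\mathcal{L}_Y$. $\mathbf{LSS}$ is the category of locally small spaces and their bounded continuous mappings. A locally small space is partially topological if $\mathcal{L}_X=\mathcal{L}_X^{swo}$ (equivalently,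 $\mathcal{L}_X^o=\mathcal{L}_X^{wo}$); $\mathbf{LSS}_{pt}$ is the full subcategory of $\mathbf{LSS}$ of partially topological locally small spaces. A bornology on a set $X$ is a family $\mathcal{B}\subseteq\mathcal{P}(X)$ such that $A\cup B\in\mathcal{B}$ whenever $A,B\in\mathcal{B}$, and $A\in\mathcal{B}$ whenever $A\subseteq B\in\mathcal{B}$. A bornological universe is a triple $(X,\tau_X,\mathcal{B}_X)$ with $X$ a set, $\tau_X$ a topology on $X$ and $\mathcal{B}_X$ a bornology on $X$. A basis of the bornology $\mathcal{B}_X$ is a family $\mathbb{B}\subseteq\mathcal{B}_X$ such that every element of $\mathcal{B}_X$ is contained in some element of $\mathbb{B}$; it is an open basis if all elements of $\mathbb{B}$ are open in $(X,\tau_X)$. A mapping $f:X\to Y$ between bornological universes $(X,\tau_X,\mathcal{B}_X)$ and $(Y,\tau_Y,\mathcal{B}_Y)$ is bounded if $f(B)\in\mathcal{B}_Y$ for all $B\in\mathcal{B}_X$, and continuous if it is continuous as a map $(X,\tau_X)\to(Y,\tau_Y)$. $\mathbf{OpenBorUniv}$ is the category of bornological universes having open bases of the bornology and their bounded continuous mappings. Two concrete categories over sets are concretely isomorphic if there is an isomorphism of categories between them preserving underlying sets and underlying mappings.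
   Formalization: A bornology on X is additionally required to cover X and to contain the empty set; without this a one-point set carries three bornological universes with open bases but only one locally small space, so the claim fails. *)

theory Defs
  imports "HOL-Analysis.Abstract_Topology"
begin

section \<open>Categories and functors\<close>

text \<open>\<open>Comp C g f\<close> is the composite \<open>g \<circ> f\<close>; only its values on composable pairs of arrows matter.\<close>

record ('o, 'm) category =
  Obj :: "'o set"
  Arr :: "'m set"
  Dom :: "'m \<Rightarrow> 'o"
  Cod :: "'m \<Rightarrow> 'o"
  Ide :: "'o \<Rightarrow> 'm"
  Comp :: "'m \<Rightarrow> 'm \<Rightarrow> 'm"

definition is_category :: "('o, 'm, 'z) category_scheme \<Rightarrow> bool" where
  "is_category C \<longleftrightarrow>
     (\<forall>f\<in>Arr C. Dom C f \<in> Obj C \<and> Cod C f \<in> Obj C) \<and>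
     (\<forall>A\<in>Obj C. Ide C A \<in> Arr C \<and> Dom C (Ide C A) = A \<and> Cod C (Ide C A) = A) \<and>
     (\<forall>f\<in>Arr C. \<forall>g\<in>Arr C. Cod C f = Dom C g \<longrightarrow>
        Comp C g f \<in> Arr C \<and> Dom C (Comp C g f) = Dom C f \<and> Cod C (Comp C g f) = Cod C g) \<and>
     (\<forall>f\<in>Arr C. Comp C f (Ide C (Dom C f)) = f \<and> Comp C (Ide C (Cod C f)) f = f) \<and>
     (\<forall>f\<in>Arr C. \<forall>g\<in>Arr C. \<forall>h\<in>Arr C. Cod C f = Dom C g \<and> Cod C g = Dom C h \<longrightarrow>
        Comp C h (Comp C g f) = Comp C (Comp C h g) f)"

definition is_functor ::
  "('o, 'm, 'z) category_scheme \<Rightarrow> ('p, 'n, 'y) category_scheme \<Rightarrow> ('o \<Rightarrow> 'p) \<Rightarrow> ('m \<Rightarrow> 'n) \<Rightarrow> bool"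
where
  "is_functor C D Fo Fm \<longleftrightarrow>
     (\<forall>A\<in>Obj C. Fo A \<in> Obj D) \<and>
     (\<forall>f\<in>Arr C. Fm f \<in> Arr D \<and> Dom D (Fm f) = Fo (Dom C f) \<and> Cod D (Fm f) = Fo (Cod C f)) \<and>
     (\<forall>A\<in>Obj C. Fm (Ide C A) = Ide D (Fo A)) \<and>
     (\<forall>f\<in>Arr C. \<forall>g\<in>Arr C. Cod C f = Dom C g \<longrightarrow> Fm (Comp C g f) = Comp D (Fm g) (Fm f))"

definition faithful_functor ::
  "('o, 'm, 'z) category_scheme \<Rightarrow> ('p, 'n, 'y) category_scheme \<Rightarrow> ('o \<Rightarrow> 'p) \<Rightarrow> ('m \<Rightarrow> 'n) \<Rightarrow> bool"
where
  "faithful_functor C D Fo Fm \<longleftrightarrow> is_functor C D Fo Fm \<and>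
     (\<forall>f\<in>Arr C. \<forall>g\<in>Arr C. Dom C f = Dom C g \<and> Cod C f = Cod C g \<and> Fm f = Fm g \<longrightarrow> f = g)"

definition isomorphism_of_categories ::
  "('o, 'm, 'z) category_scheme \<Rightarrow> ('p, 'n, 'y) category_scheme \<Rightarrow> ('o \<Rightarrow> 'p) \<Rightarrow> ('m \<Rightarrow> 'n) \<Rightarrow> bool"
where
  "isomorphism_of_categories C D Fo Fm \<longleftrightarrow> is_functor C D Fo Fm \<and>
     (\<exists>Go Gm. is_functor D C Go Gm \<and>
        (\<forall>A\<in>Obj C. Go (Fo A) = A) \<and> (\<forall>f\<in>Arr C. Gm (Fm f) = f) \<and>
        (\<forall>B\<in>Obj D. Fo (Go B) = B) \<and> (\<forall>g\<in>Arr D. Fm (Gm g) = g))"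

section \<open>Constructs\<close>

text \<open>
  The category of sets has as objects the subsets of the type \<open>'a\<close>, which plays the role of the
  universe. A mapping from \<open>X\<close> to \<open>Y\<close> is a triple \<open>(X, f, Y)\<close> in which \<open>f\<close> is
  \<open>undefined\<close> outside \<open>X\<close>, so that equality of arrows is equality of mappings with specified
  source and target.
\<close>

definition SETS :: "('a set, 'a set \<times> ('a \<Rightarrow> 'a) \<times> 'a set) category" where
  "SETS = \<lparr>Obj = UNIV,
           Arr = {(X, f, Y). f \<in> X \<rightarrow>\<^sub>E Y},
           Dom = (\<lambda>(X, f, Y). X),
           Cod = (\<lambda>(X, f, Y). Y),
           Ide = (\<lambda>X. (X, \<lambda>x\<in>X. x, X)),
           Comp = (\<lambda>(Y', g, Z) (X, f, Y). (X, compose X g f, Z))\<rparr>"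

record ('o, 'm, 'a) construct = "('o, 'm) category" +
  Und_obj :: "'o \<Rightarrow> 'a set"
  Und_arr :: "'m \<Rightarrow> 'a set \<times> ('a \<Rightarrow> 'a) \<times> 'a set"

definition is_construct :: "('o, 'm, 'a) construct \<Rightarrow> bool" where
  "is_construct C \<longleftrightarrow> is_category C \<and> faithful_functor C SETS (Und_obj C) (Und_arr C)"

definition concretely_isomorphic :: "('o, 'm, 'a) construct \<Rightarrow> ('p, 'n, 'a) construct \<Rightarrow> bool" where
  "concretely_isomorphic C D \<longleftrightarrow> is_construct C \<and> is_construct D \<and>
     (\<exists>Fo Fm. isomorphism_of_categories C D Fo Fm \<and>
        (\<forall>A\<in>Obj C. Und_obj D (Fo A) = Und_obj C A) \<and>
        (\<forall>f\<in>Arr C. Und_arr D (Fm f) = Und_arr C f))"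

definition full_subconstruct :: "('o, 'm, 'a) construct \<Rightarrow> ('o \<Rightarrow> bool) \<Rightarrow> ('o, 'm, 'a) construct" where
  "full_subconstruct C P =
     C\<lparr>Obj := {A \<in> Obj C. P A}, Arr := {f \<in> Arr C. P (Dom C f) \<and> P (Cod C f)}\<rparr>"

text \<open>
  The construct of structured sets from the class \<open>\<O>\<close>, with underlying sets given by
  \<open>carrier\<close>; its arrows are the mappings \<open>f\<close> between underlying sets such that
  \<open>hom A B f\<close> holds.
\<close>

definition structured_sets ::
  "'o set \<Rightarrow> ('o \<Rightarrow> 'a set) \<Rightarrow> ('o \<Rightarrow> 'o \<Rightarrow> ('a \<Rightarrow> 'a) \<Rightarrow> bool) \<Rightarrow>
   ('o, 'o \<times> ('a \<Rightarrow> 'a) \<times> 'o, 'a) construct"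
where
  "structured_sets \<O> carrier hom =
     \<lparr>Obj = \<O>,
      Arr = {(A, f, B). A \<in> \<O> \<and> B \<in> \<O> \<and> f \<in> carrier A \<rightarrow>\<^sub>E carrier B \<and> hom A B f},
      Dom = (\<lambda>(A, f, B). A),
      Cod = (\<lambda>(A, f, B). B),
      Ide = (\<lambda>A. (A, \<lambda>x\<in>carrier A. x, A)),
      Comp = (\<lambda>(B', g, C) (A, f, B). (A, compose (carrier A) g f, C)),
      Und_obj = carrier,
      Und_arr = (\<lambda>(A, f, B). (carrier A, f, carrier B))\<rparr>"

section \<open>Locally small spaces\<close>

type_synonym 'a lss = "'a set \<times> 'a set set"

definition locally_small_space :: "'a set \<Rightarrow> 'a set set \<Rightarrow> bool" where
  "locally_small_space X \<L> \<longleftrightarrow> \<L> \<subseteq> Pow X \<and> {} \<in> \<L> \<and>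
     (\<forall>L\<in>\<L>. \<forall>M\<in>\<L>. L \<inter> M \<in> \<L> \<and> L \<union> M \<in> \<L>) \<and> \<Union>\<L> = X"

definition lss_open :: "'a set \<Rightarrow> 'a set set \<Rightarrow> 'a set set" where
  "lss_open X \<L> = {V. V \<subseteq> X \<and> (\<forall>L\<in>\<L>. V \<inter> L \<in> \<L>)}"

definition lss_small :: "'a set \<Rightarrow> 'a set set \<Rightarrow> 'a set set" where
  "lss_small X \<L> = {B. B \<subseteq> X \<and> (\<exists>L\<in>\<L>. B \<subseteq> L)}"

definition lss_weakly_open :: "'a set set \<Rightarrow> 'a set set" where
  "lss_weakly_open \<L> = {\<Union>\<U> | \<U>. \<U> \<subseteq> \<L>}"

definition lss_small_weakly_open :: "'a set \<Rightarrow> 'a set set \<Rightarrow> 'a set set" where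
  "lss_small_weakly_open X \<L> = lss_weakly_open \<L> \<inter> lss_small X \<L>"

definition partially_topological :: "'a set \<Rightarrow> 'a set set \<Rightarrow> bool" where
  "partially_topological X \<L> \<longleftrightarrow> \<L> = lss_small_weakly_open X \<L>"

definition lss_bounded :: "'a lss \<Rightarrow> 'a lss \<Rightarrow> ('a \<Rightarrow> 'a) \<Rightarrow> bool" where
  "lss_bounded = (\<lambda>(X, \<L>) (Y, \<M>) f. \<forall>L\<in>\<L>. \<exists>M\<in>\<M>. L \<subseteq> f -` M \<inter> X)"

definition lss_continuous :: "'a lss \<Rightarrow> 'a lss \<Rightarrow> ('a \<Rightarrow> 'a) \<Rightarrow> bool" where
  "lss_continuous = (\<lambda>(X, \<L>) (Y, \<M>) f. \<forall>M\<in>\<M>. f -` M \<inter> X \<in> lss_open X \<L>)"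

definition LSS :: "('a lss, 'a lss \<times> ('a \<Rightarrow> 'a) \<times> 'a lss, 'a) construct" where
  "LSS = structured_sets {(X, \<L>). locally_small_space X \<L>} fst
           (\<lambda>A B f. lss_bounded A B f \<and> lss_continuous A B f)"

definition LSS_pt :: "('a lss, 'a lss \<times> ('a \<Rightarrow> 'a) \<times> 'a lss, 'a) construct" where
  "LSS_pt = full_subconstruct LSS (\<lambda>(X, \<L>). partially_topological X \<L>)"

section \<open>Bornological universes\<close>

type_synonym 'a bor_univ = "'a set \<times> 'a topology \<times> 'a set set"

text \<open>
  A bornology on \<open>X\<close> is required to cover \<open>X\<close>, as in the standard definition of a bornology.
  The requirement \<open>{} \<in> \<B>\<close> follows from covering unless \<open>X = {}\<close>, where it excludes the
  empty family.
  Without these two conditions a one-point set carries three bornological universes with an open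
  basis of the bornology, but only one locally small space.
\<close>

definition bornology_on :: "'a set \<Rightarrow> 'a set set \<Rightarrow> bool" where
  "bornology_on X \<B> \<longleftrightarrow> \<B> \<subseteq> Pow X \<and> {} \<in> \<B> \<and> \<Union>\<B> = X \<and>
     (\<forall>A\<in>\<B>. \<forall>B\<in>\<B>. A \<union> B \<in> \<B>) \<and> (\<forall>B\<in>\<B>. \<forall>A. A \<subseteq> B \<longrightarrow> A \<in> \<B>)"

definition bornological_universe :: "'a set \<Rightarrow> 'a topology \<Rightarrow> 'a set set \<Rightarrow> bool" where
  "bornological_universe X T \<B> \<longleftrightarrow> topspace T = X \<and> bornology_on X \<B>"

definition bornology_basis :: "'a set set \<Rightarrow> 'a set set \<Rightarrow> bool" where
  "bornology_basis \<B> \<B>\<^sub>0 \<longleftrightarrow> \<B>\<^sub>0 \<subseteq> \<B> \<and> (\<forall>B\<in>\<B>. \<exists>B\<^sub>0\<in>\<B>\<^sub>0. B \<subseteq> B\<^sub>0)"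

definition has_open_basis :: "'a topology \<Rightarrow> 'a set set \<Rightarrow> bool" where
  "has_open_basis T \<B> \<longleftrightarrow> (\<exists>\<B>\<^sub>0. bornology_basis \<B> \<B>\<^sub>0 \<and> (\<forall>B\<in>\<B>\<^sub>0. openin T B))"

definition bor_bounded :: "'a bor_univ \<Rightarrow> 'a bor_univ \<Rightarrow> ('a \<Rightarrow> 'a) \<Rightarrow> bool" where
  "bor_bounded = (\<lambda>(X, T, \<B>) (Y, S, \<C>) f. \<forall>B\<in>\<B>. f ` B \<in> \<C>)"

definition bor_continuous :: "'a bor_univ \<Rightarrow> 'a bor_univ \<Rightarrow> ('a \<Rightarrow> 'a) \<Rightarrow> bool" where
  "bor_continuous = (\<lambda>(X, T, \<B>) (Y, S, \<C>) f. continuous_map T S f)"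

definition OpenBorUniv ::
  "('a bor_univ, 'a bor_univ \<times> ('a \<Rightarrow> 'a) \<times> 'a bor_univ, 'a) construct"
where
  "OpenBorUniv = structured_sets {(X, T, \<B>). bornological_universe X T \<B> \<and> has_open_basis T \<B>} fst
                   (\<lambda>A B f. bor_bounded A B f \<and> bor_continuous A B f)"

end

theory Submission
  imports Defs
begin

text \<open>
  A partially topological locally small space and a bornological universe with an open basis
  carry the same information. A space \<open>(X, \<L>)\<close> has the topology of its weakly open sets and
  the bornology of its small sets, and \<open>\<L>\<close> itself is an open basis of that bornology. Conversely,
  a universe \<open>(X, T, \<B>)\<close> has the family of its bounded open sets.

  Starting from a space, the bounded open sets are the small weakly open ones, so being partially
  topological says exactly that they are the members of \<open>\<L>\<close>. Starting from a universe, the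
  open basis makes every bounded set lie in a bounded open one, which
  recovers \<open>\<B>\<close>; since the bounded sets cover \<open>X\<close>, it also makes every open set a union
  of bounded open ones, which recovers \<open>T\<close>. Hence the two assignments are mutually inverse
  (\<open>bounded_opens_universe_of_lss\<close>, \<open>universe_of_lss_bounded_opens\<close>).

  They also have the same morphisms (\<open>lss_morphism_iff_bor_morphism\<close>). Boundedness is the same
  on both sides, since the small sets are the subsets of members of \<open>\<L>\<close>. Continuity into a
  locally small space \<open>(Y, \<M>)\<close> asks preimages of members of \<open>\<M>\<close> to be open, that is, to meet
  members of \<open>\<L>\<close> in members of \<open>\<L>\<close>. It implies topological continuity because open sets are
  weakly open; the converse holds because a weakly open subset of a member of \<open>\<L>\<close> is small, hence
  itself in \<open>\<L>\<close> when \<open>(X, \<L>)\<close> is partially topological. The rest is the general fact that a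
  bijection between classes of structured sets which preserves carriers and morphisms is a
  concrete isomorphism (\<open>concretely_isomorphic_structured_sets\<close>).
\<close>

section \<open>Constructs of structured sets\<close>

lemma structured_sets_simps:
  "Obj (structured_sets \<O> carrier hom) = \<O>"
  "Arr (structured_sets \<O> carrier hom) =
     {(A, f, B). A \<in> \<O> \<and> B \<in> \<O> \<and> f \<in> carrier A \<rightarrow>\<^sub>E carrier B \<and> hom A B f}"
  "Dom (structured_sets \<O> carrier hom) = (\<lambda>(A, f, B). A)"
  "Cod (structured_sets \<O> carrier hom) = (\<lambda>(A, f, B). B)"
  "Ide (structured_sets \<O> carrier hom) = (\<lambda>A. (A, \<lambda>x\<in>carrier A. x, A))"
  "Comp (structured_sets \<O> carrier hom) =
     (\<lambda>(B', g, C) (A, f, B). (A, compose (carrier A) g f, C))"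
  "Und_obj (structured_sets \<O> carrier hom) = carrier"
  "Und_arr (structured_sets \<O> carrier hom) = (\<lambda>(A, f, B). (carrier A, f, carrier B))"
  by (simp_all add: structured_sets_def)

lemma SETS_simps:
  "Obj SETS = UNIV"
  "Arr SETS = {(X, f, Y). f \<in> X \<rightarrow>\<^sub>E Y}"
  "Dom SETS = (\<lambda>(X, f, Y). X)"
  "Cod SETS = (\<lambda>(X, f, Y). Y)"
  "Ide SETS = (\<lambda>X. (X, \<lambda>x\<in>X. x, X))"
  "Comp SETS = (\<lambda>(Y', g, Z) (X, f, Y). (X, compose X g f, Z))"
  by (simp_all add: SETS_def)

lemma full_subconstruct_structured_sets:
  "full_subconstruct (structured_sets \<O> carrier hom) P =
     structured_sets {A \<in> \<O>. P A} carrier hom"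
  by (auto simp: full_subconstruct_def structured_sets_def)

lemma compose_PiE:
  assumes "f \<in> X \<rightarrow>\<^sub>E Y" "g \<in> Y \<rightarrow>\<^sub>E Z"
  shows "compose X g f \<in> X \<rightarrow>\<^sub>E Z"
  using assms by (auto simp: compose_def PiE_iff)

lemma is_construct_structured_sets:
  assumes id: "\<And>A. A \<in> \<O> \<Longrightarrow> hom A A (\<lambda>x\<in>carrier A. x)"
    and comp: "\<And>A B C f g. \<lbrakk>A \<in> \<O>; B \<in> \<O>; C \<in> \<O>;
          f \<in> carrier A \<rightarrow>\<^sub>E carrier B; g \<in> carrier B \<rightarrow>\<^sub>E carrier C; hom A B f; hom B C g\<rbrakk>
        \<Longrightarrow> hom A C (compose (carrier A) g f)"
  shows "is_construct (structured_sets \<O> carrier hom)"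
proof -
  have "is_category (structured_sets \<O> carrier hom)"
    unfolding is_category_def structured_sets_simps
    by (auto simp: id intro: comp compose_PiE)
       (auto simp: compose_def PiE_iff extensional_def fun_eq_iff)
  moreover have "faithful_functor (structured_sets \<O> carrier hom) SETS carrier
      (\<lambda>(A, f, B). (carrier A, f, carrier B))"
    unfolding faithful_functor_def is_functor_def structured_sets_simps SETS_simps by auto
  ultimately show ?thesis
    by (simp add: is_construct_def structured_sets_simps)
qed

text \<open>
  An arrow keeps its underlying map and only has the structures at its two ends replaced, so
  functoriality in both directions is automatic. For the same reason the identity and composition
  laws on the source follow from those on the target.
\<close>

lemma concretely_isomorphic_structured_sets:
  assumes F: "\<And>A. A \<in> \<O> \<Longrightarrow> F A \<in> \<P>" and G: "\<And>B. B \<in> \<P> \<Longrightarrow> G B \<in> \<O>"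
    and GF: "\<And>A. A \<in> \<O> \<Longrightarrow> G (F A) = A" and FG: "\<And>B. B \<in> \<P> \<Longrightarrow> F (G B) = B"
    and carrier: "\<And>A. A \<in> \<O> \<Longrightarrow> carrier' (F A) = carrier A"
    and hom: "\<And>A B f. \<lbrakk>A \<in> \<O>; B \<in> \<O>; f \<in> carrier A \<rightarrow>\<^sub>E carrier B\<rbrakk>
        \<Longrightarrow> hom A B f \<longleftrightarrow> hom' (F A) (F B) f"
    and id: "\<And>A. A \<in> \<P> \<Longrightarrow> hom' A A (\<lambda>x\<in>carrier' A. x)"
    and comp: "\<And>A B C f g. \<lbrakk>A \<in> \<P>; B \<in> \<P>; C \<in> \<P>;
          f \<in> carrier' A \<rightarrow>\<^sub>E carrier' B; g \<in> carrier' B \<rightarrow>\<^sub>E carrier' C; hom' A B f; hom' B C g\<rbrakk>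
        \<Longrightarrow> hom' A C (compose (carrier' A) g f)"
  shows "concretely_isomorphic (structured_sets \<O> carrier hom) (structured_sets \<P> carrier' hom')"
proof -
  let ?C = "structured_sets \<O> carrier hom" and ?D = "structured_sets \<P> carrier' hom'"
  let ?Fm = "\<lambda>(A, f, B). (F A, f, F B)" and ?Gm = "\<lambda>(A, f, B). (G A, f, G B)"
  have carrier_G: "carrier (G B) = carrier' B" if "B \<in> \<P>" for B
    using that carrier[of "G B"] G FG by simp
  have hom_G: "hom (G A) (G B) f \<longleftrightarrow> hom' A B f"
    if "A \<in> \<P>" "B \<in> \<P>" "f \<in> carrier' A \<rightarrow>\<^sub>E carrier' B" for A B f
    using that hom[of "G A" "G B" f] G FG by (simp add: carrier_G)
  have "is_construct ?C"
  proof (rule is_construct_structured_sets)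
    fix A assume "A \<in> \<O>"
    then show "hom A A (\<lambda>x\<in>carrier A. x)"
      using id[of "F A"] by (subst hom) (auto simp: F carrier)
  next
    fix A B C f g
    assume *: "A \<in> \<O>" "B \<in> \<O>" "C \<in> \<O>" "f \<in> carrier A \<rightarrow>\<^sub>E carrier B"
      "g \<in> carrier B \<rightarrow>\<^sub>E carrier C" "hom A B f" "hom B C g"
    then have "hom' (F A) (F B) f" "hom' (F B) (F C) g"
      using hom by auto
    then have "hom' (F A) (F C) (compose (carrier A) g f)"
      using * comp[of "F A" "F B" "F C" f g] by (simp add: F carrier)
    then show "hom A C (compose (carrier A) g f)"
      using * compose_PiE hom by metis
  qed
  moreover have "is_construct ?D"
    using id comp by (rule is_construct_structured_sets)
  moreover have "is_functor ?C ?D F ?Fm"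
    unfolding is_functor_def structured_sets_simps by (auto simp: F carrier hom)
  moreover have "is_functor ?D ?C G ?Gm"
    unfolding is_functor_def structured_sets_simps by (auto simp: G carrier_G hom_G)
  then have "\<exists>Go Gm. is_functor ?D ?C Go Gm \<and>
      (\<forall>A\<in>Obj ?C. Go (F A) = A) \<and> (\<forall>f\<in>Arr ?C. Gm (?Fm f) = f) \<and>
      (\<forall>B\<in>Obj ?D. F (Go B) = B) \<and> (\<forall>g\<in>Arr ?D. ?Fm (Gm g) = g)"
    by (intro exI[of _ G] exI[of _ ?Gm]) (auto simp: structured_sets_simps GF FG)
  moreover have "\<forall>A\<in>Obj ?C. Und_obj ?D (F A) = Und_obj ?C A"
    "\<forall>f\<in>Arr ?C. Und_arr ?D (?Fm f) = Und_arr ?C f"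
    by (auto simp: structured_sets_simps carrier)
  ultimately show ?thesis
    unfolding concretely_isomorphic_def isomorphism_of_categories_def by blast
qed

section \<open>From locally small spaces to bornological universes\<close>

definition weak_topology :: "'a set set \<Rightarrow> 'a topology" where
  "weak_topology \<L> = topology (\<lambda>U. U \<in> lss_weakly_open \<L>)"

lemma weakly_open_iff: "U \<in> lss_weakly_open \<L> \<longleftrightarrow> (\<forall>x\<in>U. \<exists>L\<in>\<L>. x \<in> L \<and> L \<subseteq> U)"
proof
  assume "\<forall>x\<in>U. \<exists>L\<in>\<L>. x \<in> L \<and> L \<subseteq> U"
  then have "U = \<Union>{L \<in> \<L>. L \<subseteq> U}" by blast
  then show "U \<in> lss_weakly_open \<L>" unfolding lss_weakly_open_def by blast
qed (auto simp: lss_weakly_open_def)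

text \<open>
  Weakly open sets are by definition unions of members of \<open>\<L>\<close>, and \<open>\<L>\<close> is a base of a
  topology because it is closed under binary intersections.
\<close>

lemma openin_weak_topology:
  assumes "locally_small_space X \<L>"
  shows "openin (weak_topology \<L>) U \<longleftrightarrow> U \<in> lss_weakly_open \<L>"
proof -
  have "S \<inter> T \<in> lss_weakly_open \<L>" if "S \<in> lss_weakly_open \<L>" "T \<in> lss_weakly_open \<L>" for S T
    unfolding weakly_open_iff
  proof
    fix x assume "x \<in> S \<inter> T"
    then obtain L M where "L \<in> \<L>" "x \<in> L" "L \<subseteq> S" "M \<in> \<L>" "x \<in> M" "M \<subseteq> T"
      using \<open>S \<in> _\<close> \<open>T \<in> _\<close> unfolding weakly_open_iff by blast
    moreover from this have "L \<inter> M \<in> \<L>"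
      using assms unfolding locally_small_space_def by blast
    ultimately show "\<exists>L\<in>\<L>. x \<in> L \<and> L \<subseteq> S \<inter> T" by blast
  qed
  moreover have "\<Union>\<K> \<in> lss_weakly_open \<L>" if "\<forall>K\<in>\<K>. K \<in> lss_weakly_open \<L>" for \<K>
    using that unfolding weakly_open_iff by (meson Union_iff Union_upper order_trans)
  ultimately have "istopology (\<lambda>U. U \<in> lss_weakly_open \<L>)"
    unfolding istopology_def by blast
  then show ?thesis
    unfolding weak_topology_def by simp
qed

lemma member_imp_weakly_open: "L \<in> \<L> \<Longrightarrow> L \<in> lss_weakly_open \<L>"
  by (auto simp: weakly_open_iff)

lemma topspace_weak_topology:
  assumes "locally_small_space X \<L>"
  shows "topspace (weak_topology \<L>) = X"
proof
  show "topspace (weak_topology \<L>) \<subseteq> X"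
    using assms openin_topspace[of "weak_topology \<L>"]
    unfolding openin_weak_topology[OF assms] weakly_open_iff locally_small_space_def by blast
  have "openin (weak_topology \<L>) X"
    using assms unfolding openin_weak_topology[OF assms] weakly_open_iff locally_small_space_def
    by blast
  then show "X \<subseteq> topspace (weak_topology \<L>)" by (rule openin_subset)
qed

definition universe_of_lss :: "'a lss \<Rightarrow> 'a bor_univ" where
  "universe_of_lss = (\<lambda>(X, \<L>). (X, weak_topology \<L>, lss_small X \<L>))"

lemma bornology_on_small:
  assumes "locally_small_space X \<L>"
  shows "bornology_on X (lss_small X \<L>)"
proof -
  have "A \<union> B \<in> lss_small X \<L>" if "A \<in> lss_small X \<L>" "B \<in> lss_small X \<L>" for A B
  proof -
    obtain L M where "L \<in> \<L>" "A \<subseteq> L" "M \<in> \<L>" "B \<subseteq> M" "A \<subseteq> X" "B \<subseteq> X"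
      using \<open>A \<in> _\<close> \<open>B \<in> _\<close> unfolding lss_small_def by blast
    moreover from this have "L \<union> M \<in> \<L>"
      using assms unfolding locally_small_space_def by blast
    ultimately show ?thesis
      unfolding lss_small_def by blast
  qed
  moreover have "\<L> \<subseteq> lss_small X \<L>"
    using assms unfolding lss_small_def locally_small_space_def by blast
  moreover have "\<Union>(lss_small X \<L>) \<subseteq> X"
    unfolding lss_small_def by blast
  moreover have "A \<in> lss_small X \<L>" if "A \<subseteq> B" "B \<in> lss_small X \<L>" for A B
    using that unfolding lss_small_def by blast
  ultimately show ?thesis
    using assms unfolding bornology_on_def locally_small_space_def by blast
qed

lemma open_basis_small:
  assumes "locally_small_space X \<L>"
  shows "has_open_basis (weak_topology \<L>) (lss_small X \<L>)"
proof -
  have "bornology_basis (lss_small X \<L>) \<L>"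
    using assms unfolding bornology_basis_def lss_small_def locally_small_space_def by blast
  then show ?thesis
    unfolding has_open_basis_def openin_weak_topology[OF assms]
    using member_imp_weakly_open by blast
qed

section \<open>From bornological universes to locally small spaces\<close>

lemma bornology_on_subset:
  assumes "bornology_on X \<B>" "B \<in> \<B>"
  shows "B \<subseteq> X" and "A \<subseteq> B \<Longrightarrow> A \<in> \<B>"
  using assms by (auto simp: bornology_on_def)

definition bounded_opens :: "'a topology \<Rightarrow> 'a set set \<Rightarrow> 'a set set" where
  "bounded_opens T \<B> = {U \<in> \<B>. openin T U}"

definition lss_of_universe :: "'a bor_univ \<Rightarrow> 'a lss" where
  "lss_of_universe = (\<lambda>(X, T, \<B>). (X, bounded_opens T \<B>))"

lemma bounded_subset_bounded_open:
  assumes "has_open_basis T \<B>" "B \<in> \<B>"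
  obtains U where "U \<in> bounded_opens T \<B>" "B \<subseteq> U"
  using assms unfolding has_open_basis_def bornology_basis_def bounded_opens_def by blast

lemma small_bounded_opens:
  assumes "bornological_universe X T \<B>" "has_open_basis T \<B>"
  shows "lss_small X (bounded_opens T \<B>) = \<B>"
proof
  have bor: "bornology_on X \<B>"
    using assms(1) by (simp add: bornological_universe_def)
  show "lss_small X (bounded_opens T \<B>) \<subseteq> \<B>"
    using bornology_on_subset(2)[OF bor] by (auto simp: lss_small_def bounded_opens_def)
  show "\<B> \<subseteq> lss_small X (bounded_opens T \<B>)"
  proof
    fix B assume "B \<in> \<B>"
    moreover from this obtain U where "U \<in> bounded_opens T \<B>" "B \<subseteq> U"
      using bounded_subset_bounded_open assms(2) by blast
    ultimately show "B \<in> lss_small X (bounded_opens T \<B>)"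
      using bornology_on_subset(1)[OF bor] unfolding lss_small_def by blast
  qed
qed

text \<open>
  Every point of \<open>X\<close> lies in a bounded set, hence in a bounded open one. So an open set is the
  union of its intersections with bounded open sets, which are again bounded and open.
\<close>

lemma weakly_open_bounded_opens:
  assumes "bornological_universe X T \<B>" "has_open_basis T \<B>"
  shows "U \<in> lss_weakly_open (bounded_opens T \<B>) \<longleftrightarrow> openin T U"
proof
  assume "U \<in> lss_weakly_open (bounded_opens T \<B>)"
  then show "openin T U"
    unfolding lss_weakly_open_def bounded_opens_def by (blast intro: openin_Union)
next
  assume U: "openin T U"
  show "U \<in> lss_weakly_open (bounded_opens T \<B>)"
    unfolding weakly_open_iff
  proof
    fix x assume x: "x \<in> U"
    then have "x \<in> \<Union>\<B>"
      using assms(1) openin_subset[OF U]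
      by (auto simp: bornological_universe_def bornology_on_def)
    then obtain B where "B \<in> \<B>" "x \<in> B" by blast
    then obtain V where V: "V \<in> bounded_opens T \<B>" "x \<in> V"
      using bounded_subset_bounded_open assms(2) by blast
    then have "U \<inter> V \<in> \<B>"
      using assms(1) bornology_on_subset(2)[of X \<B> V "U \<inter> V"]
      by (simp add: bounded_opens_def bornological_universe_def)
    then have "U \<inter> V \<in> bounded_opens T \<B>"
      using U V by (auto simp: bounded_opens_def)
    then show "\<exists>L\<in>bounded_opens T \<B>. x \<in> L \<and> L \<subseteq> U"
      using x V(2) by (auto intro!: bexI[of _ "U \<inter> V"])
  qed
qed

lemma locally_small_space_bounded_opens:
  assumes "bornological_universe X T \<B>" "has_open_basis T \<B>"
  shows "locally_small_space X (bounded_opens T \<B>)"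
proof -
  have bor: "bornology_on X \<B>" and top: "topspace T = X"
    using assms(1) by (auto simp: bornological_universe_def)
  have "X \<in> lss_weakly_open (bounded_opens T \<B>)"
    using weakly_open_bounded_opens[OF assms] openin_topspace[of T] top by simp
  then have "X \<subseteq> \<Union>(bounded_opens T \<B>)"
    unfolding lss_weakly_open_def by blast
  moreover have "bounded_opens T \<B> \<subseteq> Pow X"
    using bornology_on_subset(1)[OF bor] by (auto simp: bounded_opens_def)
  moreover have "{} \<in> bounded_opens T \<B>"
    using bor unfolding bounded_opens_def bornology_on_def by simp
  moreover have "L \<inter> M \<in> bounded_opens T \<B> \<and> L \<union> M \<in> bounded_opens T \<B>"
    if "L \<in> bounded_opens T \<B>" "M \<in> bounded_opens T \<B>" for L M
  proof -
    have "L \<inter> M \<in> \<B>"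
      using that bornology_on_subset(2)[OF bor, of L "L \<inter> M"] by (simp add: bounded_opens_def)
    moreover have "L \<union> M \<in> \<B>"
      using that bor by (simp add: bounded_opens_def bornology_on_def)
    ultimately show ?thesis
      using that unfolding bounded_opens_def by auto
  qed
  ultimately show ?thesis
    unfolding locally_small_space_def by blast
qed

lemma partially_topological_bounded_opens:
  assumes "bornological_universe X T \<B>" "has_open_basis T \<B>"
  shows "partially_topological X (bounded_opens T \<B>)"
  unfolding partially_topological_def lss_small_weakly_open_def small_bounded_opens[OF assms]
  using weakly_open_bounded_opens[OF assms] by (auto simp: bounded_opens_def)

section \<open>The two assignments are mutually inverse and preserve morphisms\<close>

lemma bounded_opens_universe_of_lss:
  assumes "locally_small_space X \<L>" "partially_topological X \<L>"
  shows "bounded_opens (weak_topology \<L>) (lss_small X \<L>) = \<L>"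
proof -
  have "bounded_opens (weak_topology \<L>) (lss_small X \<L>) = lss_small_weakly_open X \<L>"
    unfolding bounded_opens_def lss_small_weakly_open_def openin_weak_topology[OF assms(1)]
    by blast
  then show ?thesis
    using assms(2) unfolding partially_topological_def by simp
qed

lemma universe_of_lss_bounded_opens:
  assumes "bornological_universe X T \<B>" "has_open_basis T \<B>"
  shows "universe_of_lss (X, bounded_opens T \<B>) = (X, T, \<B>)"
proof -
  have "weak_topology (bounded_opens T \<B>) = T"
    unfolding topology_eq openin_weak_topology[OF locally_small_space_bounded_opens[OF assms]]
    using weakly_open_bounded_opens[OF assms] by simp
  then show ?thesis
    by (simp add: universe_of_lss_def small_bounded_opens[OF assms])
qed

lemma lss_bounded_iff_bor_bounded:
  assumes "locally_small_space X \<L>" "locally_small_space Y \<M>" "f \<in> X \<rightarrow> Y"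
  shows "lss_bounded (X, \<L>) (Y, \<M>) f \<longleftrightarrow>
    bor_bounded (universe_of_lss (X, \<L>)) (universe_of_lss (Y, \<M>)) f"
proof
  assume bounded: "lss_bounded (X, \<L>) (Y, \<M>) f"
  have "f ` B \<in> lss_small Y \<M>" if B: "B \<in> lss_small X \<L>" for B
  proof -
    obtain L where "L \<in> \<L>" "B \<subseteq> L"
      using B unfolding lss_small_def by blast
    moreover from this obtain M where "M \<in> \<M>" "L \<subseteq> f -` M \<inter> X"
      using bounded by (auto simp: lss_bounded_def)
    ultimately show ?thesis
      using assms(3) unfolding lss_small_def by blast
  qed
  then show "bor_bounded (universe_of_lss (X, \<L>)) (universe_of_lss (Y, \<M>)) f"
    by (simp add: bor_bounded_def universe_of_lss_def)
next
  assume bounded: "bor_bounded (universe_of_lss (X, \<L>)) (universe_of_lss (Y, \<M>)) f"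
  have "\<exists>M\<in>\<M>. L \<subseteq> f -` M \<inter> X" if L: "L \<in> \<L>" for L
  proof -
    have "L \<in> lss_small X \<L>" "L \<subseteq> X"
      using L assms(1) unfolding lss_small_def locally_small_space_def by blast+
    then have "f ` L \<in> lss_small Y \<M>"
      using bounded by (simp add: bor_bounded_def universe_of_lss_def)
    then obtain M where "M \<in> \<M>" "f ` L \<subseteq> M"
      by (auto simp: lss_small_def)
    then show ?thesis
      using \<open>L \<subseteq> X\<close> by (auto intro!: bexI[of _ M])
  qed
  then show "lss_bounded (X, \<L>) (Y, \<M>) f"
    by (simp add: lss_bounded_def)
qed

lemma open_imp_weakly_open:
  assumes "locally_small_space X \<L>" "V \<in> lss_open X \<L>"
  shows "V \<in> lss_weakly_open \<L>"
  unfolding weakly_open_iff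
proof
  fix x assume x: "x \<in> V"
  then have "x \<in> \<Union>\<L>"
    using assms by (auto simp: locally_small_space_def lss_open_def)
  then obtain L where "L \<in> \<L>" "x \<in> L" by blast
  moreover from this have "V \<inter> L \<in> \<L>"
    using assms(2) by (simp add: lss_open_def)
  ultimately show "\<exists>L\<in>\<L>. x \<in> L \<and> L \<subseteq> V"
    using x by (auto intro!: bexI[of _ "V \<inter> L"])
qed

text \<open>
  The intersection of a weakly open set with a member \<open>L\<close> of \<open>\<L>\<close> is weakly open and, being
  contained in \<open>L\<close>, small.
\<close>

lemma weakly_open_imp_open:
  assumes "locally_small_space X \<L>" "partially_topological X \<L>" "V \<in> lss_weakly_open \<L>"
  shows "V \<in> lss_open X \<L>"
proof -
  have "V \<inter> L \<in> \<L>" if L: "L \<in> \<L>" for L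
  proof -
    have "openin (weak_topology \<L>) (V \<inter> L)"
      using L assms(3) member_imp_weakly_open[OF L]
      by (auto simp: openin_weak_topology[OF assms(1), symmetric])
    then have "V \<inter> L \<in> lss_small_weakly_open X \<L>"
      using L assms(1)
      unfolding openin_weak_topology[OF assms(1)] lss_small_weakly_open_def lss_small_def
        locally_small_space_def by blast
    then show ?thesis
      using assms(2) unfolding partially_topological_def by simp
  qed
  moreover have "V \<subseteq> X"
    using assms(1,3) unfolding lss_weakly_open_def locally_small_space_def by blast
  ultimately show ?thesis
    unfolding lss_open_def by blast
qed

text \<open>
  In a partially topological source the open sets are exactly the weakly open ones. As preimages
  commute with unions, it makes no difference whether the preimages of all weakly open sets of the
  target are tested or only those of the members of the base \<open>\<M>\<close>.
\<close>

lemma lss_continuous_iff_bor_continuous: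
  assumes X: "locally_small_space X \<L>" "partially_topological X \<L>"
    and Y: "locally_small_space Y \<M>" and f: "f \<in> X \<rightarrow> Y"
  shows "lss_continuous (X, \<L>) (Y, \<M>) f \<longleftrightarrow>
    bor_continuous (universe_of_lss (X, \<L>)) (universe_of_lss (Y, \<M>)) f"
proof -
  have "lss_continuous (X, \<L>) (Y, \<M>) f \<longleftrightarrow> (\<forall>M\<in>\<M>. f -` M \<inter> X \<in> lss_weakly_open \<L>)"
    using open_imp_weakly_open[OF X(1)] weakly_open_imp_open[OF X]
    by (auto simp: lss_continuous_def)
  also have "\<dots> \<longleftrightarrow> (\<forall>U\<in>lss_weakly_open \<M>. f -` U \<inter> X \<in> lss_weakly_open \<L>)"
  proof safe
    fix U assume M: "\<forall>M\<in>\<M>. f -` M \<inter> X \<in> lss_weakly_open \<L>" and U: "U \<in> lss_weakly_open \<M>"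
    show "f -` U \<inter> X \<in> lss_weakly_open \<L>"
      unfolding weakly_open_iff
    proof
      fix x assume x: "x \<in> f -` U \<inter> X"
      then obtain M where "M \<in> \<M>" "f x \<in> M" "M \<subseteq> U"
        using U unfolding weakly_open_iff by blast
      then obtain L where "L \<in> \<L>" "x \<in> L" "L \<subseteq> f -` M \<inter> X"
        using M x unfolding weakly_open_iff by blast
      then show "\<exists>L\<in>\<L>. x \<in> L \<and> L \<subseteq> f -` U \<inter> X"
        using \<open>M \<subseteq> U\<close> by blast
    qed
  qed (use member_imp_weakly_open in blast)
  also have "\<dots> \<longleftrightarrow> continuous_map (weak_topology \<L>) (weak_topology \<M>) f"
    using f unfolding continuous_map_def topspace_weak_topology[OF X(1)]
      topspace_weak_topology[OF Y] openin_weak_topology[OF X(1)] openin_weak_topology[OF Y]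
    by (simp add: vimage_def Int_def conj_commute Ball_def)
  finally show ?thesis
    by (simp add: bor_continuous_def universe_of_lss_def)
qed

lemma lss_morphism_iff_bor_morphism:
  assumes "locally_small_space X \<L>" "partially_topological X \<L>"
    and "locally_small_space Y \<M>" and "f \<in> X \<rightarrow> Y"
  shows "lss_bounded (X, \<L>) (Y, \<M>) f \<and> lss_continuous (X, \<L>) (Y, \<M>) f \<longleftrightarrow>
    bor_bounded (universe_of_lss (X, \<L>)) (universe_of_lss (Y, \<M>)) f \<and>
    bor_continuous (universe_of_lss (X, \<L>)) (universe_of_lss (Y, \<M>)) f"
  using assms lss_bounded_iff_bor_bounded lss_continuous_iff_bor_continuous by blast

section \<open>Identities and composites of bounded continuous maps\<close>

lemma bor_morphism_id:
  assumes "bornological_universe X T \<B>"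
  shows "bor_bounded (X, T, \<B>) (X, T, \<B>) (\<lambda>x\<in>X. x)"
    and "bor_continuous (X, T, \<B>) (X, T, \<B>) (\<lambda>x\<in>X. x)"
proof -
  have "(\<lambda>x\<in>X. x) ` B = B" if "B \<in> \<B>" for B
  proof -
    have "B \<subseteq> X"
      using assms that bornology_on_subset(1) unfolding bornological_universe_def by metis
    then show ?thesis by force
  qed
  then show "bor_bounded (X, T, \<B>) (X, T, \<B>) (\<lambda>x\<in>X. x)"
    by (simp add: bor_bounded_def)
  have "topspace T = X"
    using assms unfolding bornological_universe_def by simp
  then show "bor_continuous (X, T, \<B>) (X, T, \<B>) (\<lambda>x\<in>X. x)"
    unfolding bor_continuous_def by (auto intro: continuous_map_eq[OF continuous_map_id])
qed

lemma bor_morphism_compose: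
  assumes "bornological_universe X T \<B>"
  shows "\<lbrakk>bor_bounded (X, T, \<B>) (Y, S, \<C>) f; bor_bounded (Y, S, \<C>) (Z, R, \<D>) g\<rbrakk>
      \<Longrightarrow> bor_bounded (X, T, \<B>) (Z, R, \<D>) (compose X g f)"
    and "\<lbrakk>bor_continuous (X, T, \<B>) (Y, S, \<C>) f; bor_continuous (Y, S, \<C>) (Z, R, \<D>) g\<rbrakk>
      \<Longrightarrow> bor_continuous (X, T, \<B>) (Z, R, \<D>) (compose X g f)"
proof -
  assume bounded: "bor_bounded (X, T, \<B>) (Y, S, \<C>) f" "bor_bounded (Y, S, \<C>) (Z, R, \<D>) g"
  have "compose X g f ` B \<in> \<D>" if "B \<in> \<B>" for B
  proof -
    have "B \<subseteq> X"
      using assms that bornology_on_subset(1) unfolding bornological_universe_def by metis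
    then have "compose X g f ` B = g ` f ` B"
      by (force simp: compose_def)
    then show ?thesis
      using bounded that by (simp add: bor_bounded_def)
  qed
  then show "bor_bounded (X, T, \<B>) (Z, R, \<D>) (compose X g f)"
    by (simp add: bor_bounded_def)
next
  assume "bor_continuous (X, T, \<B>) (Y, S, \<C>) f" "bor_continuous (Y, S, \<C>) (Z, R, \<D>) g"
  then have "continuous_map T R (g \<circ> f)"
    unfolding bor_continuous_def by (auto intro: continuous_map_compose)
  moreover have "topspace T = X"
    using assms unfolding bornological_universe_def by simp
  ultimately show "bor_continuous (X, T, \<B>) (Z, R, \<D>) (compose X g f)"
    unfolding bor_continuous_def by (auto intro: continuous_map_eq simp: compose_def)
qed

section \<open>The concrete isomorphism\<close>

theorem theorem2p66:
  shows "concretely_isomorphic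
           (LSS_pt :: ('a lss, 'a lss \<times> ('a \<Rightarrow> 'a) \<times> 'a lss, 'a) construct)
           (OpenBorUniv :: ('a bor_univ, 'a bor_univ \<times> ('a \<Rightarrow> 'a) \<times> 'a bor_univ, 'a) construct)"
  unfolding LSS_pt_def LSS_def full_subconstruct_structured_sets OpenBorUniv_def
proof (rule concretely_isomorphic_structured_sets[where F = universe_of_lss and G = lss_of_universe],
    goal_cases)
  case (1 A)
  then show ?case
    by (auto simp: universe_of_lss_def bornological_universe_def topspace_weak_topology
        bornology_on_small open_basis_small)
next
  case (2 B)
  then show ?case
    by (auto simp: lss_of_universe_def locally_small_space_bounded_opens
        partially_topological_bounded_opens)
next
  case (3 A)
  then show ?case
    by (auto simp: lss_of_universe_def universe_of_lss_def bounded_opens_universe_of_lss)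
next
  case (4 B)
  then show ?case
    by (auto simp: lss_of_universe_def universe_of_lss_bounded_opens)
next
  case (5 A)
  show ?case
    by (simp add: universe_of_lss_def split: prod.split)
next
  case (6 A B f)
  then show ?case
    using lss_morphism_iff_bor_morphism[of "fst A" "snd A" "fst B" "snd B" f]
    by (simp add: split_beta PiE_iff Pi_iff)
next
  case (7 A)
  then show ?case
    by (auto intro: bor_morphism_id)
next
  case (8 A B C f g)
  then show ?case
    by (auto intro: bor_morphism_compose)
qed

end
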